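(* The Generalized Continuum Hypothesis (GCH: $2^{\aleph}=\aleph^{+}$ for every infinite cardinal $\aleph$, where $\aleph^{+}$, also written $\aleph+1$, is the successor cardinal) is equivalent to the following assertion: for every infinite cardinal $\aleph\ge\aleph_0$, every set $X\subseteq 2^{\aleph}$ (so $X$ has cardinality $\le 2^{\aleph}$) and every binary sequence $x$ of length at most $\aleph$, the amount of information needed to decide the relation $x\in X$ by an interleaved enumeration of $X$ and $2^{\aleph}-X$ is $<\aleph^{+}$.
   Context: $2^{\aleph}$ denotes the set of all binary sequences of length at most $\aleph$ (equivalently binary $\aleph$-sequences), and also its cardinality. An enumeration of a set of cardinality $\kappa$ is a listing indexed by ordinals below the least ordinal of cardinality $\kappa$. Given enumerations $f$ of $U$ and $g$ of $V$, their interleaved enumeration $h$ is defined by writing each ordinal $\alpha$ in Cantor normal form as $\mathrm{inf}(\alpha)+\mathrm{fin}(\alpha)$ with $\mathrm{inf}(\alpha)$ the (possibly zero) infinite part and $\mathrm{fin}(\alpha)<\omega$ the finite part, and setting $h_\alpha=f_{\mathrm{inf}(\alpha)+\mathrm{fin}(\alpha)/2}$ if $\mathrm{fin}(\alpha)$ is even and $h_\alpha=g_{\mathrm{inf}(\alpha)+(\mathrm{fin}(\alpha)+1)/2}$ if $\mathrm{fin}(\alpha)$ is odd. Deciding $x\in X$ by an interleaved enumeration of $X$ and $2^{\aleph}-X$ means running through the interleaved enumeration until $x$ is found (in $X$ or in its complement); the amount of information (number of bits) needed is the number of steps taken, i.e. the cardinality of the position at which $x$ is reached.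
   Formalization: For odd fin(α) the interleaving uses g at inf(α)+(fin(α)−1)/2 instead of (fin(α)+1)/2, which would never reach g_0 or g at limit ordinals; the equivalence is shown for the infinite cardinals up to any given bound, on both sides. *)

theory Defs
  imports Main
begin

unbundle cardinal_syntax

text \<open>
  An infinite cardinal is a relation \<open>r\<close> with \<open>Cinfinite r\<close>.  The elements of
  \<open>Field r\<close>, ordered by \<open>r\<close>, play the role of the ordinals below it, and the ordinals up to
  and including it are the initial segments (order filters) of \<open>r\<close>.
\<close>

text \<open>Binary sequences of length at most \<open>r\<close>: the domain of a sequence is its length.\<close>

definition binseqs :: "'a rel \<Rightarrow> ('a \<rightharpoonup> bool) set" where
  "binseqs r = {s. ofilter r (dom s)}"

text \<open>
  In the following \<open>W\<close> is a well-order without a greatest element, and \<open>a \<in> Field W\<close> stands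
  for the ordinal that is the order type of \<open>underS W a\<close>.
\<close>

definition plus_fin :: "'b rel \<Rightarrow> 'b \<Rightarrow> nat \<Rightarrow> 'b" where
  "plus_fin W a n = ((\<lambda>b. wo_rel.suc W {b}) ^^ n) a"

definition zero_or_limit :: "'b rel \<Rightarrow> 'b \<Rightarrow> bool" where
  "zero_or_limit W a \<longleftrightarrow> a \<in> Field W \<and> \<not> (\<exists>b \<in> Field W. a = wo_rel.suc W {b})"

text \<open>
  In the Cantor normal form of an ordinal, the sum of the terms with nonzero exponent is zero
  or a limit ordinal, and the remaining term is finite; this determines both parts.
\<close>

definition inf_part :: "'b rel \<Rightarrow> 'b \<Rightarrow> 'b" where
  "inf_part W a = (THE l. zero_or_limit W l \<and> (\<exists>n. a = plus_fin W l n))"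

definition fin_part :: "'b rel \<Rightarrow> 'b \<Rightarrow> nat" where
  "fin_part W a = (THE n. a = plus_fin W (inf_part W a) n)"

text \<open>
  \<open>|U|\<close> is a well-order of \<open>U\<close> of least order type, so the domain of an enumeration consists
  of the ordinals below the least ordinal of the cardinality of \<open>U\<close>.  This needs \<open>W\<close> to
  be long enough, that is, \<open>|U| \<le>o W\<close>.
\<close>

definition enumeration :: "'b rel \<Rightarrow> 'c set \<Rightarrow> ('b \<rightharpoonup> 'c) \<Rightarrow> bool" where
  "enumeration W U f \<longleftrightarrow>
     dom f = {a \<in> Field W. Restr W (underS W a) <o |U| } \<and> ran f = U \<and> inj_on f (dom f)"

text \<open>
  At odd finite part \<open>2 * k + 1\<close> the entry is that of \<open>g\<close> with finite part \<open>k\<close>.  With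
  \<open>k + 1\<close> in place of \<open>k\<close> the entries of \<open>g\<close> at zero and at the limit ordinals would be
  omitted.  Positions may be empty, since one of the two enumerations can be shorter.
\<close>

definition interleave :: "'b rel \<Rightarrow> ('b \<rightharpoonup> 'c) \<Rightarrow> ('b \<rightharpoonup> 'c) \<Rightarrow> ('b \<rightharpoonup> 'c)" where
  "interleave W f g a =
     (if a \<notin> Field W then None
      else if even (fin_part W a) then f (plus_fin W (inf_part W a) (fin_part W a div 2))
      else g (plus_fin W (inf_part W a) ((fin_part W a - 1) div 2)))"

definition position :: "'b rel \<Rightarrow> ('b \<rightharpoonup> 'c) \<Rightarrow> 'c \<Rightarrow> 'b" where
  "position W h x = wo_rel.minim W {a \<in> Field W. h a = Some x}"

definition information :: "'b rel \<Rightarrow> ('b \<rightharpoonup> 'c) \<Rightarrow> 'c \<Rightarrow> 'b rel" where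
  "information W h x = |underS W (position W h x)|"

end

theory Submission
  imports Defs
begin

text \<open>
  The set \<open>binseqs r\<close> has cardinality \<open>2\<^sup>r\<close>, so under GCH every position in a well-order of type
  \<open>|binseqs r|\<close> has at most \<open>r\<close> predecessors.  Conversely, if \<open>r\<^sup>+ < 2\<^sup>r\<close>, let \<open>p\<close> be the position
  whose predecessors have order type \<open>r\<^sup>+\<close>, and enumerate \<open>X = binseqs r\<close> by the identity.  As \<open>p\<close> is a limit,
  the interleaving with the empty enumeration leaves the entry \<open>p\<close> in place, so deciding
  \<open>p \<in> X\<close> takes \<open>r\<^sup>+\<close> steps.
\<close>

section \<open>Cardinality of initial segments of a well-order\<close>

lemma card_of_underS_ordLeq:
  assumes "Well_order W"
  shows "card_of (underS W a) \<le>o Restr W (underS W a)"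
proof -
  have "wo_rel.ofilter W (underS W a)"
    using assms by (simp add: wo_rel_def wo_rel.underS_ofilter)
  hence "Field (Restr W (underS W a)) = underS W a"
    by (rule Field_Restr_ofilter[OF assms])
  thus ?thesis
    \<comment> \<open>A cardinal is the least among all well-orders with the same field.\<close>
    using card_of_least Well_order_Restr[OF assms, of "underS W a"] by metis
qed

lemma card_of_underS_less:
  assumes "Well_order W" "Field W \<noteq> {}"
  shows "card_of (underS W a) <o W"
  by (rule ordLeq_ordLess_trans[OF card_of_underS_ordLeq underS_Restr_ordLess]) (fact assms)+

section \<open>Successors in a well-order without greatest element\<close>

locale limit_wo_rel = wo_rel W for W :: "'b rel" +
  assumes no_max: "a \<in> Field W \<Longrightarrow> \<exists>b \<in> Field W. a \<noteq> b \<and> (a, b) \<in> W"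
begin

text \<open>\<open>suc {a}\<close> is the minimum of \<open>AboveS {a}\<close>; as this set is
  nonempty, \<open>suc {a}\<close> is a genuine successor for every \<open>a\<close> in the
  field.\<close>

lemma AboveS_singleton_nonempty: "a \<in> Field W \<Longrightarrow> AboveS {a} \<noteq> {}"
  using no_max[of a] by (auto simp: AboveS_def)

lemma suc_singleton_in_Field: "a \<in> Field W \<Longrightarrow> suc {a} \<in> Field W"
  by (intro suc_inField AboveS_singleton_nonempty) auto

lemma suc_singleton_greater:
  assumes "a \<in> Field W"
  shows "suc {a} \<noteq> a" "(a, suc {a}) \<in> W"
  using suc_greater[of "{a}" a] AboveS_singleton_nonempty[OF assms] assms by auto

text \<open>An element of the field outside \<open>insert a (underS a)\<close> is strictly above
  \<open>a\<close>, hence not strictly below the least such element, \<open>suc {a}\<close>.\<close>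

lemma underS_suc_singleton:
  assumes "a \<in> Field W"
  shows "underS (suc {a}) = insert a (underS a)"
proof (intro set_eqI iffI)
  fix b assume b: "b \<in> underS (suc {a})"
  hence bF: "b \<in> Field W" by (auto simp: underS_def Field_def)
  show "b \<in> insert a (underS a)"
  proof (rule ccontr)
    assume "b \<notin> insert a (underS a)"
    hence "b \<noteq> a" "(a, b) \<in> W"
      using TOTALS assms bF by (auto simp: underS_def)
    hence "(suc {a}, b) \<in> W"
      using bF by (intro suc_least_AboveS) (auto simp: AboveS_def)
    thus False
      using b ANTISYM by (auto simp: underS_def antisym_def)
  qed
next
  fix b assume "b \<in> insert a (underS a)"
  thus "b \<in> underS (suc {a})"
    using suc_singleton_greater[OF assms] underS_incl_iff[OF LIN assms suc_singleton_in_Field[OF assms]]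
    by (auto simp: underS_def)
qed

text \<open>By \<open>underS_suc_singleton\<close>, distinct elements with the same successor would
  each lie strictly below the other.\<close>

lemma suc_singleton_inject:
  assumes "a \<in> Field W" "b \<in> Field W" "suc {a} = suc {b}"
  shows "a = b"
proof (rule ccontr)
  assume "a \<noteq> b"
  moreover have "insert a (underS a) = insert b (underS b)"
    using assms underS_suc_singleton by metis
  ultimately have "a \<in> underS b" "b \<in> underS a"
    by auto
  thus False
    using ANTISYM \<open>a \<noteq> b\<close> by (auto simp: underS_def antisym_def)
qed

section \<open>Cantor normal form: zero or a limit plus a finite part\<close>

lemma plus_fin_0 [simp]: "plus_fin W a 0 = a"
  by (simp add: plus_fin_def)

lemma plus_fin_Suc [simp]: "plus_fin W a (Suc n) = suc {plus_fin W a n}"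
  by (simp add: plus_fin_def)

lemma plus_fin_in_Field: "a \<in> Field W \<Longrightarrow> plus_fin W a n \<in> Field W"
  by (induction n) (auto intro: suc_singleton_in_Field)

lemma zero_or_limit_eq_plus_fin:
  assumes "zero_or_limit W l" "a \<in> Field W" "l = plus_fin W a n"
  shows "n = 0"
  using assms plus_fin_in_Field[of a] by (cases n) (auto simp: zero_or_limit_def)

text \<open>Uniqueness of the normal form: injectivity of the successor strips steps from both sides
  until one side is its zero or limit part, and then the other side has no step left either.\<close>

lemma plus_fin_inject:
  assumes "zero_or_limit W l" "zero_or_limit W l'" "plus_fin W l m = plus_fin W l' n"
  shows "l = l' \<and> m = n"
  using assms(3)
proof (induction m arbitrary: n)
  case 0
  thus ?case
    using zero_or_limit_eq_plus_fin[OF assms(1), of l' n] assms(2)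
    by (auto simp: zero_or_limit_def)
next
  case (Suc m)
  have F: "l \<in> Field W" "l' \<in> Field W"
    using assms(1,2) by (auto simp: zero_or_limit_def)
  show ?case
  proof (cases n)
    case 0
    thus ?thesis
      using zero_or_limit_eq_plus_fin[OF assms(2) F(1), of "Suc m"] Suc.prems by auto
  next
    case (Suc k)
    hence "plus_fin W l m = plus_fin W l' k"
      using Suc.prems F by (auto intro: suc_singleton_inject plus_fin_in_Field)
    thus ?thesis using Suc.IH Suc by auto
  qed
qed

text \<open>Existence of the normal form, by well-founded induction: an element that is neither zero
  nor a limit is the successor of a smaller one.\<close>

lemma ex_limit_plus_fin:
  assumes "a \<in> Field W"
  shows "\<exists>l n. zero_or_limit W l \<and> a = plus_fin W l n"
  using assms
proof (induction a rule: well_order_induct)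
  case (1 a)
  show ?case
  proof (cases "zero_or_limit W a")
    case True
    thus ?thesis by (metis plus_fin_0)
  next
    case False
    then obtain b where b: "b \<in> Field W" "a = suc {b}"
      using 1(2) by (auto simp: zero_or_limit_def)
    then obtain l n where "zero_or_limit W l" "b = plus_fin W l n"
      using 1(1) suc_singleton_greater[of b] by metis
    thus ?thesis using b by (metis plus_fin_Suc)
  qed
qed

lemma inf_part_plus_fin: "zero_or_limit W l \<Longrightarrow> inf_part W (plus_fin W l n) = l"
  unfolding inf_part_def by (rule the_equality) (auto dest: plus_fin_inject)

lemma fin_part_plus_fin: "zero_or_limit W l \<Longrightarrow> fin_part W (plus_fin W l n) = n"
  unfolding fin_part_def inf_part_plus_fin by (rule the_equality) (auto dest: plus_fin_inject)

text \<open>With \<open>f\<close> the identity, position l + n holds l + n/2 if n is even and is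
  empty if n is odd. The value \<open>p\<close>, being zero or a limit, forces n/2 = 0.\<close>

lemma interleave_empty_at_limit:
  assumes p: "zero_or_limit W p" and f: "f = (\<lambda>a. if a \<in> Field W then Some a else None)"
  shows "interleave W f Map.empty a = Some p \<longleftrightarrow> a = p"
proof
  assume h: "interleave W f Map.empty a = Some p"
  hence "a \<in> Field W" by (auto simp: interleave_def split: if_splits)
  then obtain l n where a: "zero_or_limit W l" "a = plus_fin W l n"
    using ex_limit_plus_fin by blast
  have n: "even n" "p = plus_fin W l (n div 2)"
    using h a by (auto simp: interleave_def inf_part_plus_fin fin_part_plus_fin f split: if_splits)
  hence "n div 2 = 0"
    using zero_or_limit_eq_plus_fin[OF p _ n(2)] a(1) by (auto simp: zero_or_limit_def)
  thus "a = p" using n a by (auto elim!: evenE)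
next
  assume "a = p"
  thus "interleave W f Map.empty a = Some p"
    using p inf_part_plus_fin[OF p, of 0] fin_part_plus_fin[OF p, of 0]
    by (auto simp: interleave_def f zero_or_limit_def)
qed

section \<open>An infinite cardinal as a limit position\<close>

lemma ex_limit_card_of_underS:
  assumes k: "Cinfinite k" and less: "k <o W"
  shows "\<exists>p. zero_or_limit W p \<and> k =o |underS p|"
proof -
  have "Well_order k"
    using k by (auto simp: card_order_on_def)
  then obtain p where p: "p \<in> Field W" "k =o Restr W (underS p)"
    using less ordLess_iff_ordIso_Restr[OF WELL] by blast
  have cp: "k =o |underS p|"
    using card_of_cong[OF p(2)] card_of_Field_ordIso[of k] k
      Field_Restr_ofilter[OF WELL underS_ofilter, of p]
    by (metis ordIso_symmetric ordIso_transitive)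
  \<comment> \<open>If \<open>p\<close> were the successor of \<open>b\<close>, the infinite sets
    \<open>underS p\<close> and \<open>underS b\<close> would differ by one element and so be
    equinumerous. The cardinal \<open>k\<close> would then fit into the segment below
    \<open>b\<close>, although its order type is that of the longer segment below
    \<open>p\<close>.\<close>
  moreover have "zero_or_limit W p"
  proof (rule ccontr)
    assume "\<not> zero_or_limit W p"
    then obtain b where b: "b \<in> Field W" "p = suc {b}"
      using p(1) by (auto simp: zero_or_limit_def)
    have u: "underS p = insert b (underS b)"
      using underS_suc_singleton b by simp
    have "infinite (underS p)"
      using Cinfinite_cong[OF cp k] by (simp add: cinfinite_def Field_card_of)
    hence "infinite (underS b)"
      using u by simp
    then obtain h where "bij_betw h (underS b) (underS p)"
      using infinite_imp_bij_betw2[of "underS b" b] u by auto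
    hence "|underS p| =o |underS b|"
      using card_of_ordIso ordIso_symmetric by blast
    hence "k \<le>o Restr W (underS b)"
      using cp card_of_underS_ordLeq[OF WELL] ordIso_transitive ordIso_ordLeq_trans by blast
    moreover have "underS b \<subset> underS p"
      using u by (auto simp: Order_Relation.underS_def)
    hence "Restr W (underS b) <o Restr W (underS p)"
      using ofilter_subset_ordLess[OF WELL underS_ofilter underS_ofilter] by blast
    ultimately have "k <o Restr W (underS p)"
      by (rule ordLeq_ordLess_trans)
    thus False
      using p(2) not_ordLess_ordIso by blast
  qed
  ultimately show ?thesis by blast
qed

end

section \<open>The number of binary sequences\<close>

lemma card_of_binseqs:
  assumes "Cinfinite r"
  shows "|binseqs r| =o ctwo ^c r"
proof -
  have wo: "wo_rel r"
    using assms by (auto simp: wo_rel_def card_order_on_def)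
  have inf: "infinite (Field r)"
    using assms by (simp add: cinfinite_def)
  have "|Pow (Field r)| \<le>o |binseqs r|"
  proof (rule card_of_ordLeqI)
    \<comment> \<open>Subsets of \<open>Field r\<close> become their characteristic functions, which
      are sequences of full length.\<close>
    show "inj_on (\<lambda>S a. if a \<in> Field r then Some (a \<in> S) else None) (Pow (Field r))"
      by (rule inj_onI) (auto simp: fun_eq_iff split: if_splits)
  next
    fix S :: "'a set"
    have "dom (\<lambda>a. if a \<in> Field r then Some (a \<in> S) else None) = Field r"
      by (auto split: if_splits)
    thus "(\<lambda>a. if a \<in> Field r then Some (a \<in> S) else None) \<in> binseqs r"
      using wo_rel.Field_ofilter[OF wo] by (simp add: binseqs_def)
  qed
  moreover have "|binseqs r| \<le>o |Pow (Field r) \<times> Pow (Field r)|"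
  proof (rule card_of_ordLeqI)
    \<comment> \<open>The set of places with value \<open>True\<close> does not tell
      \<open>False\<close> from undefined; the domain does.\<close>
    show "inj_on (\<lambda>s. (dom s, {a. s a = Some True})) (binseqs r)"
    proof (rule inj_onI, rule ext)
      fix s t :: "'a \<rightharpoonup> bool" and a
      assume "(dom s, {a. s a = Some True}) = (dom t, {a. t a = Some True})"
      hence "a \<in> dom s \<longleftrightarrow> a \<in> dom t" "s a = Some True \<longleftrightarrow> t a = Some True"
        by auto
      thus "s a = t a"
        by (cases "s a"; cases "t a") auto
    qed
  next
    fix s assume "s \<in> binseqs r"
    hence "dom s \<subseteq> Field r"
      using wo by (auto simp: binseqs_def wo_rel.ofilter_def)
    thus "(dom s, {a. s a = Some True}) \<in> Pow (Field r) \<times> Pow (Field r)"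
      by auto
  qed
  moreover have "|Pow (Field r) \<times> Pow (Field r)| =o |Pow (Field r)|"
    using inf by (intro card_of_Times_same_infinite) simp
  ultimately have "|binseqs r| =o |Pow (Field r)|"
    using ordLeq_ordIso_trans ordIso_iff_ordLeq by blast
  moreover have "|Pow (Field r)| =o ctwo ^c r"
    using card_of_Pow_Func by (simp add: cexp_def ctwo_def Field_card_of)
  ultimately show ?thesis
    using ordIso_transitive by blast
qed

section \<open>Infinite cardinals as orders of positions, and two enumerations\<close>

lemma limit_wo_rel_card_of:
  assumes "infinite A"
  shows "limit_wo_rel |A|"
proof -
  interpret wo_rel "|A|"
    by (simp add: wo_rel_def card_of_Well_order)
  show ?thesis
    using infinite_Card_order_limit[OF card_of_Card_order, of A] assms
    by unfold_locales (auto simp: Field_card_of)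
qed

text \<open>The positions in \<open>|A|\<close> are the elements of \<open>A\<close> themselves, and
  each proper initial segment is shorter than \<open>|A|\<close>, so the required domain is all of
  \<open>A\<close>.\<close>

lemma enumeration_id:
  "enumeration |A| A (\<lambda>a. if a \<in> A then Some a else None)"
proof -
  have "Restr |A| (underS |A| a) <o |A|" if "a \<in> A" for a
    using underS_Restr_ordLess[OF card_of_Well_order, of A a] that by (auto simp: Field_card_of)
  thus ?thesis
    by (auto simp: enumeration_def Field_card_of ran_def inj_on_def split: if_splits)
qed

text \<open>Nothing is shorter than the empty well-order, so the required domain is empty.\<close>

lemma enumeration_empty: "enumeration W {} Map.empty"
proof -
  have "\<not> R <o |{} :: 'c set|" for R :: "'a rel"
  proof
    assume less: "R <o |{} :: 'c set|"
    hence "|{} :: 'c set| \<le>o R"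
      by (intro card_of_empty1) (simp add: ordLess_def)
    thus False
      using less not_ordLess_ordLeq by blast
  qed
  thus ?thesis by (auto simp: enumeration_def)
qed

section \<open>GCH and the amount of information\<close>

theorem theorem9:
  shows "(\<forall>r :: 'a rel. Cinfinite r \<longrightarrow> ctwo ^c r =o cardSuc r) \<longleftrightarrow>
         (\<forall>r :: 'a rel. Cinfinite r \<longrightarrow>
            (\<forall>X \<subseteq> binseqs r. \<forall>x \<in> binseqs r. \<forall>f g.
               enumeration |binseqs r| X f \<and> enumeration |binseqs r| (binseqs r - X) g \<longrightarrow>
               information |binseqs r| (interleave |binseqs r| f g) x <o cardSuc r))"
    (is "?GCH \<longleftrightarrow> ?Info")
proof
  assume gch: ?GCH
  \<comment> \<open>In the cardinal \<open>|binseqs r|\<close> every \<open>underS\<close> has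
    smaller cardinality than the whole, and GCH identifies the whole with
    \<open>cardSuc r\<close>.\<close>
  have "information (card_of (binseqs r)) h x <o cardSuc r"
    if r: "Cinfinite r" and x: "x \<in> binseqs r" for r :: "'a rel" and h x
  proof -
    have "card_of (binseqs r) =o cardSuc r"
      using gch r card_of_binseqs ordIso_transitive by blast
    thus ?thesis
      unfolding information_def
      using card_of_underS_less[OF card_of_Well_order] x ordLess_ordIso_trans
      by (metis Field_card_of empty_iff)
  qed
  thus ?Info by blast
next
  assume info: ?Info
  have "ctwo ^c r =o cardSuc r" if r: "Cinfinite r" for r :: "'a rel"
  proof -
    define W where "W = card_of (binseqs r)"
    have FW: "Field W = binseqs r"
      by (simp add: W_def Field_card_of)
    have ci: "Cinfinite (cardSuc r)"
      using r by (rule Cinfinite_cardSuc)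
    \<comment> \<open>By Cantor's theorem \<open>r\<close> is strictly below
      \<open>ctwo ^c r\<close>, so only a strict gap above \<open>cardSuc r\<close> remains to be
      excluded.\<close>
    have le: "cardSuc r \<le>o ctwo ^c r"
      using r by (intro cardSuc_least ordLess_ctwo_cexp Card_order_cexp) auto
    have "\<not> cardSuc r <o ctwo ^c r"
    proof
      assume "cardSuc r <o ctwo ^c r"
      hence less: "cardSuc r <o W"
        using card_of_binseqs[OF r] ordIso_symmetric ordLess_ordIso_trans unfolding W_def by blast
      have "infinite (binseqs r)"
        using cinfinite_mono[OF ordLess_imp_ordLeq[OF less]] ci FW by (auto simp: cinfinite_def)
      then interpret limit_wo_rel W
        unfolding W_def by (rule limit_wo_rel_card_of)
      obtain p where p: "zero_or_limit W p" "cardSuc r =o card_of (underS p)"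
        using ex_limit_card_of_underS[OF ci less] by blast
      \<comment> \<open>Positions in \<open>W\<close> are themselves binary sequences, so
        \<open>p\<close> serves both as a position and as the sequence to be decided.\<close>
      have pF: "p \<in> binseqs r"
        using p(1) FW by (simp add: zero_or_limit_def)
      let ?f = "\<lambda>a. if a \<in> binseqs r then Some a else None"
      \<comment> \<open>No other position holds \<open>p\<close>, so the search cannot stop
        earlier.\<close>
      have "{a \<in> Field W. interleave W ?f Map.empty a = Some p} = {p}"
        using interleave_empty_at_limit[OF p(1), of ?f] pF FW by auto
      moreover have "minim {p} = p"
        using minim_in[of "{p}"] pF FW by auto
      ultimately have "information W (interleave W ?f Map.empty) p = card_of (underS p)"
        by (simp add: information_def position_def)
      moreover have "information W (interleave W ?f Map.empty) p <o cardSuc r"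
      proof -
        have "enumeration W (binseqs r) ?f" "enumeration W (binseqs r - binseqs r) Map.empty"
          using enumeration_id[of "binseqs r"] enumeration_empty[of W] by (simp_all add: W_def)
        thus ?thesis
          using info r pF unfolding W_def by blast
      qed
      ultimately show False
        using p(2) not_ordLess_ordIso ordIso_symmetric by metis
    qed
    thus ?thesis
      using le ordLeq_iff_ordLess_or_ordIso ordIso_symmetric by blast
  qed
  thus ?GCH by blast
qed

end
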